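(* Let $\lambda,\mu$ be infinite cardinals with $\mu\geq\lambda^+$ and $\operatorname{cf}\mu\neq\operatorname{cf}\lambda$, and let $D$ be a $(\lambda^+,\mu)$-regular ultrafilter. Then either $D$ is $(\operatorname{cf}\lambda,\operatorname{cf}\lambda)$-regular, or there is a regular cardinal $\lambda'\leq\lambda$ such that $D$ is $(\lambda',\mu)$-regular.
   Context: We work in ZFC. For infinite cardinals $\mu,\lambda$, an ultrafilter $D$ over a set $I$ is $(\mu,\lambda)$-regular if there is an indexed family $(X_\alpha)_{\alpha<\lambda}$ of members of $D$ such that $\bigcap_{\alpha\in A}X_\alpha=\emptyset$ whenever $A\subseteq\lambda$ and $|A|=\mu$. Equivalently, there is a function $f:I\to S_\mu(\lambda)$ such that $\{i\in I\mid \alpha\in f(i)\}\in D$ for every $\alpha<\lambda$, where $S_\mu(\lambda)$ is the set of all subsets of $\lambda$ of cardinality $<\mu$. *)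

theory Defs
  imports Main
begin

unbundle cardinal_syntax

text \<open>
  An infinite cardinal is a relation \<open>r\<close> with \<^term>\<open>Cinfinite r\<close>, that is, an infinite
  cardinal order; cardinals on different types are compared by \<open>=o\<close>, \<open><o\<close> and \<open>\<le>o\<close>. The
  ordinals below the cardinal are the elements of \<^term>\<open>Field r\<close>.
\<close>

definition ultrafilter_on :: "'i set \<Rightarrow> 'i set set \<Rightarrow> bool" where
  "ultrafilter_on I D \<longleftrightarrow>
     D \<subseteq> Pow I \<and> I \<in> D \<and> {} \<notin> D \<and>
     (\<forall>X\<in>D. \<forall>Y\<in>D. X \<inter> Y \<in> D) \<and>
     (\<forall>X\<in>D. \<forall>Y. X \<subseteq> Y \<and> Y \<subseteq> I \<longrightarrow> Y \<in> D) \<and>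
     (\<forall>X. X \<subseteq> I \<longrightarrow> X \<in> D \<or> I - X \<in> D)"

text \<open>
  \<open>regular_for m l D\<close> is \<open>(m, l)\<close>-regularity of \<open>D\<close>. The index sets \<open>A\<close> have cardinality
  exactly \<open>m\<close>, so they are nonempty and the intersection is a genuine one.
\<close>

definition regular_for :: "'m rel \<Rightarrow> 'l rel \<Rightarrow> 'i set set \<Rightarrow> bool" where
  "regular_for m l D \<longleftrightarrow>
     (\<exists>X :: 'l \<Rightarrow> 'i set.
        (\<forall>a \<in> Field l. X a \<in> D) \<and>
        (\<forall>A. A \<subseteq> Field l \<and> |A| =o m \<longrightarrow> (\<Inter>a\<in>A. X a) = {}))"

text \<open>
  The cofinality is the least cardinality of a cofinal subset. \<^const>\<open>cofinal\<close> asks for strict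
  upper bounds, which makes no difference for infinite cardinals, since they have no largest
  element.
\<close>

definition cf :: "'a rel \<Rightarrow> 'a rel" where
  "cf r = |SOME K. K \<subseteq> Field r \<and> cofinal K r \<and>
             (\<forall>K'. K' \<subseteq> Field r \<and> cofinal K' r \<longrightarrow> |K| \<le>o |K'| )|"

lemma cofinal_Field:
  assumes "Cinfinite r"
  shows "cofinal (Field r) r"
  unfolding cofinal_def
  using assms infinite_Card_order_limit[of r] unfolding cinfinite_def by blast

lemma cf_witness:
  assumes "Cinfinite r"
  obtains K where "K \<subseteq> Field r" "cofinal K r" "cf r = |K|"
    "\<And>K'. K' \<subseteq> Field r \<Longrightarrow> cofinal K' r \<Longrightarrow> |K| \<le>o |K'|"
proof -
  let ?P = "\<lambda>K. K \<subseteq> Field r \<and> cofinal K r"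
  let ?R = "{|K| | K. ?P K}"
  have "?R \<noteq> {}" using cofinal_Field[OF assms] by blast
  moreover have "\<forall>c\<in>?R. Well_order c" using card_of_Well_order by auto
  ultimately obtain c where "c \<in> ?R" "\<forall>c'\<in>?R. c \<le>o c'"
    using exists_minim_Well_order[of ?R] by blast
  then have "\<exists>K. ?P K \<and> (\<forall>K'. ?P K' \<longrightarrow> |K| \<le>o |K'| )" by auto
  then have "\<exists>K. K \<subseteq> Field r \<and> cofinal K r \<and> (\<forall>K'. ?P K' \<longrightarrow> |K| \<le>o |K'| )" by blast
  from someI_ex[OF this] show thesis
    by (elim conjE) (rule that, auto simp: cf_def)
qed

lemma regularCard_iff_cf:
  assumes "Cinfinite r"
  shows "regularCard r \<longleftrightarrow> cf r =o r"
proof -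
  obtain K where K: "K \<subseteq> Field r" "cofinal K r" "cf r = |K|"
    and min: "\<And>K'. K' \<subseteq> Field r \<Longrightarrow> cofinal K' r \<Longrightarrow> |K| \<le>o |K'|"
    using cf_witness[OF assms] by blast
  have r: "|Field r| =o r" using assms card_of_Field_ordIso by blast
  show ?thesis
  proof
    assume "regularCard r"
    then show "cf r =o r" using K unfolding regularCard_def by simp
  next
    assume eq: "cf r =o r"
    show "regularCard r"
      unfolding regularCard_def
    proof (intro allI impI)
      fix K' assume K': "K' \<subseteq> Field r \<and> cofinal K' r"
      have "r \<le>o |K'|"
        using min[of K'] K' eq K(3) ordIso_ordLeq_trans ordIso_symmetric by metis
      moreover have "|K'| \<le>o r"
        using K' card_of_mono1 r ordLeq_ordIso_trans by blast
      ultimately show "|K'| =o r" by (simp add: ordIso_iff_ordLeq)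
    qed
  qed
qed

lemma regular_for_iff:
  fixes m :: "'m rel" and l :: "'l rel" and I :: "'i set"
  assumes "Cinfinite m" "ultrafilter_on I D"
  shows "regular_for m l D \<longleftrightarrow>
    (\<exists>f. (\<forall>i\<in>I. f i \<subseteq> Field l \<and> |f i| <o m) \<and> (\<forall>a\<in>Field l. {i \<in> I. a \<in> f i} \<in> D))"
proof -
  have Cm: "Card_order m" and inf: "infinite (Field m)"
    using assms(1) unfolding cinfinite_def by simp_all
  have Fm: "|Field m| =o m" using Cm by (rule card_of_Field_ordIso)
  have Wm: "Well_order m" using Cm by (rule Card_order_wo_rel[unfolded wo_rel_def])
  show ?thesis
  proof
    assume "regular_for m l D"
    then obtain X :: "'l \<Rightarrow> 'i set" where XD: "\<forall>a\<in>Field l. X a \<in> D"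
      and int: "\<forall>A. A \<subseteq> Field l \<and> |A| =o m \<longrightarrow> (\<Inter>a\<in>A. X a) = {}"
      unfolding regular_for_def by (elim exE conjE)
    have X: "X a \<in> D" if "a \<in> Field l" for a using XD that by (rule bspec)
    define f where "f i = {a \<in> Field l. i \<in> X a}" for i
    have "|f i| <o m" for i
    proof (rule ccontr)
      assume "\<not> |f i| <o m"
      then have "m \<le>o |f i|"
        using ordLess_or_ordLeq[OF card_of_Well_order[of "f i"] Wm] by blast
      then have "|Field m| \<le>o |f i|" by (rule ordIso_ordLeq_trans[OF Fm])
      then obtain g where g: "inj_on g (Field m)" "g ` Field m \<subseteq> f i"
        using card_of_ordLeq[of "Field m" "f i"] by blast
      have "|Field m| =o |g ` Field m|"
        by (rule card_of_ordIsoI[OF inj_on_imp_bij_betw[OF g(1)]])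
      then have "|g ` Field m| =o m"
        by (rule ordIso_transitive[OF ordIso_symmetric Fm])
      moreover have "g ` Field m \<subseteq> Field l" using g(2) unfolding f_def by blast
      ultimately have "(\<Inter>a\<in>g ` Field m. X a) = {}" by (intro int[rule_format] conjI)
      moreover have "i \<in> (\<Inter>a\<in>g ` Field m. X a)" using g(2) unfolding f_def by blast
      ultimately show False by blast
    qed
    moreover have "{i \<in> I. a \<in> f i} \<in> D" if "a \<in> Field l" for a
    proof -
      have "D \<subseteq> Pow I" using assms(2) unfolding ultrafilter_on_def by (rule conjunct1)
      then have "X a \<subseteq> I" using X[OF that] by auto
      then have "{i \<in> I. a \<in> f i} = X a" using that unfolding f_def by auto
      then show ?thesis using X[OF that] by simp
    qed
    moreover have "f i \<subseteq> Field l" for i unfolding f_def by blast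
    ultimately show "\<exists>f. (\<forall>i\<in>I. f i \<subseteq> Field l \<and> |f i| <o m) \<and>
        (\<forall>a\<in>Field l. {i \<in> I. a \<in> f i} \<in> D)"
      by (intro exI[of _ f] conjI ballI)
  next
    assume "\<exists>f. (\<forall>i\<in>I. f i \<subseteq> Field l \<and> |f i| <o m) \<and> (\<forall>a\<in>Field l. {i \<in> I. a \<in> f i} \<in> D)"
    then obtain f where f0: "\<forall>i\<in>I. f i \<subseteq> Field l \<and> |f i| <o m"
      and D: "\<forall>a\<in>Field l. {i \<in> I. a \<in> f i} \<in> D" by (elim exE conjE)
    have f: "|f i| <o m" if "i \<in> I" for i using f0 that by simp
    have "(\<Inter>a\<in>A. {i \<in> I. a \<in> f i}) = {}" if A: "|A| =o m" for A
    proof (rule ccontr)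
      have "A \<noteq> {}"
      proof
        assume "A = {}"
        then have "|{} :: 'l set| =o |Field m|"
          using A ordIso_transitive[OF _ ordIso_symmetric[OF Fm]] by simp
        then show False using inf card_of_ordIso_finite by fastforce
      qed
      moreover assume "(\<Inter>a\<in>A. {i \<in> I. a \<in> f i}) \<noteq> {}"
      ultimately obtain i where i: "i \<in> I" "A \<subseteq> f i" by blast
      have "m \<le>o |f i|"
        by (rule ordIso_ordLeq_trans[OF ordIso_symmetric[OF A] card_of_mono1[OF i(2)]])
      then show False using f[OF i(1)] not_ordLess_ordLeq by metis
    qed
    then show "regular_for m l D"
      unfolding regular_for_def using D
      by (intro exI[of _ "\<lambda>a. {i \<in> I. a \<in> f i}"] conjI ballI allI impI) simp_all
  qed
qed

end

theory Submission
  imports Defs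
begin

text \<open>
  Let \<open>f\<close> witness \<open>(\<lambda>\<^sup>+, \<mu>)\<close>-regularity and embed each \<open>f(i)\<close>, which has at most \<open>\<lambda>\<close> elements,
  into \<open>\<lambda>\<close> by \<open>j i\<close>. If \<open>D\<close> is not \<open>(cf \<lambda>, cf \<lambda>)\<close>-regular, then for each \<open>a < \<mu>\<close> the function
  \<open>i \<mapsto> j i a\<close> is bounded by some \<open>x < \<lambda>\<close> on a set in \<open>D\<close>. Let \<open>A x\<close> be the set of all \<open>a\<close> bounded by
  \<open>x\<close>. The sets \<open>A x\<close>, for \<open>x\<close> in a cofinal subset of \<open>\<lambda>\<close> of type \<open>cf \<lambda>\<close>, form an increasing chain
  with union \<open>\<mu>\<close>; since \<open>cf \<mu> \<noteq> cf \<lambda>\<close>, some \<open>A x\<close> has cardinality \<open>\<mu>\<close>. The part of \<open>f(i)\<close> embedded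
  below \<open>x\<close> has cardinality at most \<open>|x| < \<lambda>\<close>, hence less than a regular cardinal \<open>\<lambda>' \<le> \<lambda>\<close> that does
  not depend on \<open>i\<close>, namely \<open>|x|\<^sup>+\<close>, or \<open>\<omega>\<close> if \<open>x\<close> is finite.
\<close>

section \<open>Cofinal subsets of infinite cardinals\<close>

lemma Cinfinite_order:
  assumes "Cinfinite r"
  shows "Card_order r" "Well_order r" "trans r" "antisym r" "wo_rel r" "infinite (Field r)"
    "|Field r| =o r"
  using assms card_of_Field_ordIso[of r]
  by (auto simp: cinfinite_def card_order_on_def wo_rel_def well_order_on_def
      linear_order_on_def partial_order_on_def preorder_on_def)

lemma not_above_iff:
  assumes "Cinfinite r" "x \<in> Field r" "y \<in> Field r"
  shows "\<not> (x \<noteq> y \<and> (x, y) \<in> r) \<longleftrightarrow> (y, x) \<in> r"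
proof -
  interpret wo_rel r using Cinfinite_order(5)[OF assms(1)] .
  show ?thesis using assms(2,3) TOTALS ANTISYM REFL
    unfolding antisym_def refl_on_def by metis
qed

lemma cofinal_infinite:
  assumes r: "Cinfinite r" and "K \<subseteq> Field r" "cofinal K r"
  shows "infinite K"
proof
  assume "finite K"
  then have "K \<subseteq> Field r \<Longrightarrow> \<exists>a\<in>Field r. \<forall>b\<in>K. (b, a) \<in> r"
  proof (induction K rule: finite_induct)
    case empty
    then show ?case using Cinfinite_order(6)[OF r] by (metis all_not_in_conv finite.emptyI)
  next
    case (insert x K)
    then obtain a where "a \<in> Field r" "\<forall>b\<in>K. (b, a) \<in> r" by auto
    then show ?case using insert.prems not_above_iff[OF r, of a x] not_above_iff[OF r, of x x]
        Cinfinite_order(3)[OF r, unfolded trans_def] by (metis insertE insert_subset)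
  qed
  then obtain a where a: "a \<in> Field r" "\<forall>b\<in>K. (b, a) \<in> r" using assms(2) by blast
  then obtain b where "b \<in> K" "a \<noteq> b" "(a, b) \<in> r" using assms(3) unfolding cofinal_def by blast
  then show False using a not_above_iff[OF r, of a b] assms(2) by blast
qed

text \<open>A set with an upper bound lies in a proper initial segment, and proper initial segments
  of a cardinal are smaller than it.\<close>

lemma ordIso_card_cofinal:
  assumes r: "Cinfinite r" and A: "A \<subseteq> Field r" "|A| =o r"
  shows "cofinal A r"
  unfolding cofinal_def
proof (rule ballI, rule ccontr)
  fix a assume a: "a \<in> Field r" and bd: "\<not> (\<exists>b\<in>A. a \<noteq> b \<and> (a, b) \<in> r)"
  \<comment> \<open>The bound \<open>a\<close> may itself belong to \<open>A\<close>, so the open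
    segment is taken below a strictly larger \<open>a'\<close>.\<close>
  obtain a' where a': "a' \<in> Field r" "a \<noteq> a'" "(a, a') \<in> r"
    using cofinal_Field[OF r] a unfolding cofinal_def by blast
  have "A \<subseteq> underS r a'"
  proof
    fix b assume b: "b \<in> A"
    then have "(b, a) \<in> r" using bd not_above_iff[OF r a, of b] A by blast
    then show "b \<in> underS r a'"
      using a' Cinfinite_order(3,4)[OF r] unfolding underS_def trans_def antisym_def by blast
  qed
  then have "|A| <o r"
    using card_of_mono1 card_of_underS[OF Cinfinite_order(1)[OF r] a'(1)] ordLeq_ordLess_trans
    by blast
  then show False using A(2) not_ordLess_ordIso by blast
qed

text \<open>
  Passing to the elements of a smallest cofinal set that exceed all earlier ones, in a
  well-order of minimal type, gives a cofinal set of order type \<open>cf r\<close>.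
\<close>

lemma cf_thin_witness:
  assumes r: "Cinfinite r"
  obtains K where "K \<subseteq> Field r" "cofinal K r" "cf r =o |K|"
    "\<And>K'. K' \<subseteq> Field r \<Longrightarrow> cofinal K' r \<Longrightarrow> |K| \<le>o |K'|"
    "\<And>A. A \<subseteq> K \<Longrightarrow> |A| =o |K| \<Longrightarrow> cofinal A r"
proof -
  obtain C where C: "C \<subseteq> Field r" "cofinal C r" "cf r = |C|"
    and min: "\<And>K'. K' \<subseteq> Field r \<Longrightarrow> cofinal K' r \<Longrightarrow> |C| \<le>o |K'|"
    using cf_witness[OF r] by blast
  define w where "w = |C|"
  have w: "Cinfinite w" and Fw: "Field w = C"
    using cofinal_infinite[OF r C(1,2)]
    by (simp_all add: w_def cinfinite_def card_of_card_order_on Field_card_of)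
  define K where "K = {x \<in> C. \<forall>y\<in>C. y \<noteq> x \<and> (y, x) \<in> w \<longrightarrow> y \<noteq> x \<and> (y, x) \<in> r}"
  have KC: "K \<subseteq> C" unfolding K_def by blast
  have above: "\<exists>b\<in>K. a \<noteq> b \<and> (a, b) \<in> r" if a: "a \<in> Field r" for a
  proof -
    interpret w: wo_rel w using Cinfinite_order(5)[OF w] .
    let ?B = "{b \<in> C. a \<noteq> b \<and> (a, b) \<in> r}"
    have B: "?B \<subseteq> Field w" "?B \<noteq> {}" using Fw C(2) a unfolding cofinal_def by blast+
    \<comment> \<open>\<open>b\<close> is the \<open>w\<close>-first element of \<open>C\<close>
      beyond \<open>a\<close>: all \<open>w\<close>-earlier ones are at most \<open>a\<close>, hence
      below \<open>b\<close>, so \<open>b\<close> qualifies for \<open>K\<close>.\<close>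
    define b where "b = w.minim ?B"
    have b: "b \<in> ?B" using w.minim_in[OF B] unfolding b_def .
    have least: "(b, y) \<in> w" if "y \<in> ?B" for y
      using w.minim_least[OF B(1) that] unfolding b_def .
    have "y \<noteq> b \<and> (y, b) \<in> r" if y: "y \<in> C" "y \<noteq> b" "(y, b) \<in> w" for y
    proof -
      have "y \<notin> ?B" using least y Cinfinite_order(4)[OF w] unfolding antisym_def by blast
      then have "(y, a) \<in> r" using y(1) C(1) not_above_iff[OF r a, of y] by blast
      then show ?thesis using y(2) b Cinfinite_order(3)[OF r] unfolding trans_def by blast
    qed
    then have "b \<in> K" using b unfolding K_def by blast
    then show ?thesis using b by blast
  qed
  have cofK: "cofinal K r" using above unfolding cofinal_def by blast
  have KF: "K \<subseteq> Field r" using KC C(1) by blast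
  have iso: "|C| =o |K|"
    using min[OF KF cofK] card_of_mono1[OF KC] by (simp add: ordIso_iff_ordLeq)
  show thesis
  proof (rule that[OF KF cofK])
    show "cf r =o |K|" using iso C(3) by simp
    show "|K| \<le>o |K'|" if "K' \<subseteq> Field r" "cofinal K' r" for K'
      by (rule ordIso_ordLeq_trans[OF ordIso_symmetric[OF iso] min[OF that]])
    show "cofinal A r" if A: "A \<subseteq> K" "|A| =o |K|" for A
      unfolding cofinal_def
    proof
      fix a assume "a \<in> Field r"
      then obtain x where x: "x \<in> K" "a \<noteq> x" "(a, x) \<in> r" using above by blast
      \<comment> \<open>Full cardinality makes \<open>A\<close> cofinal in the cardinal
        \<open>w\<close>, and on \<open>K\<close> going up in \<open>w\<close> means going up in
        \<open>r\<close>.\<close>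
      have "|A| =o w"
        unfolding w_def by (rule ordIso_transitive[OF A(2) ordIso_symmetric[OF iso]])
      then have "cofinal A w" using ordIso_card_cofinal[OF w] A(1) KC Fw by blast
      then obtain y where y: "y \<in> A" "x \<noteq> y" "(x, y) \<in> w"
        using x(1) KC Fw unfolding cofinal_def by blast
      then have "(x, y) \<in> r" using A(1) x(1) KC unfolding K_def by blast
      then show "\<exists>b\<in>A. a \<noteq> b \<and> (a, b) \<in> r"
        using x y(1) y(2) Cinfinite_order(3,4)[OF r] unfolding trans_def antisym_def by metis
    qed
  qed
qed

section \<open>Increasing chains of small sets\<close>

text \<open>Cardinal arithmetic bounds the union by the larger of \<open>l\<close> and
  \<open>c\<close>. The bound \<open>c\<close> is uniform in \<open>x\<close>: with sizes merely
  below \<open>m\<close>, the union could reach size \<open>m\<close> when the cofinality of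
  \<open>m\<close> is at most \<open>l\<close>.\<close>

lemma UNION_ordLess:
  assumes l: "Cinfinite l" and m: "Cinfinite m" and lm: "l <o m" and c: "Card_order c" "c <o m"
    and K: "|K| \<le>o l" and A: "\<And>x. x \<in> K \<Longrightarrow> |A x| \<le>o c"
  shows "|\<Union>x\<in>K. A x| <o m"
proof (cases "c \<le>o l")
  case True
  then have "\<forall>x\<in>K. |A x| \<le>o l" using A ordLeq_transitive by blast
  then have "|\<Union>x\<in>K. A x| \<le>o l"
    using card_of_UNION_ordLeq_infinite_Field[OF Cinfinite_order(6,1)[OF l] K, of A] by blast
  then show ?thesis using lm ordLeq_ordLess_trans by blast
next
  case False
  then have lc: "l \<le>o c"
    using ordLeq_total[of c l] c(1) Cinfinite_order(2)[OF l] unfolding card_order_on_def by blast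
  then have "Cinfinite c" using c(1) l cinfinite_mono by blast
  then have "|\<Union>x\<in>K. A x| \<le>o c"
    using card_of_UNION_ordLeq_infinite_Field[of c K A] ordLeq_transitive[OF K lc] A c(1)
    unfolding cinfinite_def by blast
  then show ?thesis using c(2) ordLeq_ordLess_trans by blast
qed

text \<open>A cardinality below \<open>m\<close> is the order type of a proper initial segment; the
  element \<open>a\<close> bounding it later serves as the value of a map into
  \<open>m\<close>.\<close>

lemma ordLess_card_underS:
  assumes "Cinfinite m" "|A| <o m"
  obtains a where "a \<in> Field m" "|A| \<le>o |underS m a|"
proof -
  obtain a where a: "a \<in> Field m" "|A| =o Restr m (underS m a)"
    using assms(2) ordLess_iff_ordIso_Restr[OF Cinfinite_order(2)[OF assms(1)] card_of_Well_order]
    by blast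
  have "Field (Restr m (underS m a)) \<subseteq> underS m a" by (auto simp: Field_def)
  moreover have "|A| \<le>o |Field (Restr m (underS m a))|"
    using card_of_mono2[OF ordIso_imp_ordLeq[OF a(2)]] by (simp add: Field_card_of)
  ultimately show thesis using that a(1) card_of_mono1 ordLeq_transitive by blast
qed

text \<open>
  Choosing for \<open>x \<in> K\<close> a bound on \<open>|A x|\<close> below \<open>m\<close> gives a cofinal map \<open>h\<close> from \<open>K\<close> to \<open>m\<close>; choosing
  for \<open>a\<close> in a cofinal subset of \<open>m\<close> an \<open>x\<close> with \<open>|A x|\<close> above \<open>|a|\<close> gives a cofinal map \<open>g\<close> back to \<open>l\<close>.
\<close>

lemma cf_eq_of_small_chain:
  assumes l: "Cinfinite l" and m: "Cinfinite m" and lm: "l <o m"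
    and K: "K \<subseteq> Field l" "cofinal K l" "cf l =o |K|"
    "\<And>K'. K' \<subseteq> Field l \<Longrightarrow> cofinal K' l \<Longrightarrow> |K| \<le>o |K'|"
    and mono: "\<And>x y. (x, y) \<in> l \<Longrightarrow> A x \<subseteq> A y"
    and cover: "Field m \<subseteq> (\<Union>x\<in>K. A x)"
    and small: "\<And>x. x \<in> K \<Longrightarrow> |A x| <o m"
  shows "cf m =o cf l"
proof -
  have Kl: "|K| \<le>o l"
    using card_of_mono1[OF K(1)] Cinfinite_order(7)[OF l] ordLeq_ordIso_trans by blast
  obtain C where C: "C \<subseteq> Field m" "cofinal C m" "cf m = |C|"
    "\<And>C'. C' \<subseteq> Field m \<Longrightarrow> cofinal C' m \<Longrightarrow> |C| \<le>o |C'|"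
    using cf_witness[OF m] by blast
  \<comment> \<open>Otherwise \<open>|underS m a|\<close> would be a uniform bound below
    \<open>m\<close> on all \<open>|A x|\<close>, and their union could not cover
    \<open>m\<close>.\<close>
  have big: "\<exists>x\<in>K. |underS m a| <o |A x|" if a: "a \<in> Field m" for a
  proof (rule ccontr)
    assume "\<not> ?thesis"
    then have "\<And>x. x \<in> K \<Longrightarrow> |A x| \<le>o |underS m a|"
      using not_ordLess_iff_ordLeq card_of_Well_order by blast
    then have "|\<Union>x\<in>K. A x| <o m"
      using UNION_ordLess[OF l m lm card_of_Card_order
          card_of_underS[OF Cinfinite_order(1)[OF m] a] Kl] by blast
    then have "|Field m| <o m" using card_of_mono1[OF cover] ordLeq_ordLess_trans by blast
    then show False using Cinfinite_order(7)[OF m] not_ordLess_ordIso by blast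
  qed
  have "\<exists>h. \<forall>x\<in>K. h x \<in> Field m \<and> |A x| \<le>o |underS m (h x)|"
    by (rule bchoice) (meson ordLess_card_underS[OF m] small)
  then obtain h where h: "\<And>x. x \<in> K \<Longrightarrow> h x \<in> Field m \<and> |A x| \<le>o |underS m (h x)|" by blast
  have under_mono: "|underS m a| \<le>o |underS m b|" if "(a, b) \<in> m" for a b
    using that Cinfinite_order(3,4)[OF m] unfolding trans_def antisym_def underS_def
    by (intro card_of_mono1) blast
  have "cofinal (h ` K) m"
    unfolding cofinal_def
  proof (rule ballI, rule ccontr)
    fix a assume a: "a \<in> Field m" and bd: "\<not> (\<exists>b\<in>h ` K. a \<noteq> b \<and> (a, b) \<in> m)"
    obtain x where x: "x \<in> K" "|underS m a| <o |A x|" using big[OF a] by blast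
    have "(h x, a) \<in> m" using bd x(1) h not_above_iff[OF m a, of "h x"] by blast
    then have "|A x| \<le>o |underS m a|" using h[OF x(1)] under_mono ordLeq_transitive by blast
    then show False using x(2) not_ordLess_ordLeq by blast
  qed
  moreover have "h ` K \<subseteq> Field m" using h by blast
  ultimately have "|C| \<le>o |h ` K|" using C(4) by simp
  then have CK: "|C| \<le>o |K|" by (rule ordLeq_transitive[OF _ card_of_image])
  have "\<exists>g. \<forall>a\<in>C. g a \<in> K \<and> |underS m a| <o |A (g a)|"
    by (rule bchoice) (use big C(1) in blast)
  then obtain g where g: "\<And>a. a \<in> C \<Longrightarrow> g a \<in> K \<and> |underS m a| <o |A (g a)|" by blast
  have "cofinal (g ` C) l"
    unfolding cofinal_def
  proof (rule ballI, rule ccontr)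
    fix b assume b: "b \<in> Field l" and bd: "\<not> (\<exists>y\<in>g ` C. b \<noteq> y \<and> (b, y) \<in> l)"
    \<comment> \<open>A bound \<open>b\<close> on the values of \<open>g\<close> puts every
      \<open>A (g a)\<close> inside a single \<open>A x\<close>; an \<open>a\<close> in
      \<open>C\<close> above \<open>h x\<close> then makes \<open>|A (g a)|\<close> exceed
      \<open>|A x|\<close>.\<close>
    obtain x where x: "x \<in> K" "(b, x) \<in> l" using K(2) b unfolding cofinal_def by blast
    have gx: "A (g a) \<subseteq> A x" if "a \<in> C" for a
    proof -
      have "(g a, b) \<in> l" using bd that g[OF that] K(1) not_above_iff[OF l b, of "g a"] by blast
      then show ?thesis using mono x(2) by blast
    qed
    obtain a where a: "a \<in> C" "(h x, a) \<in> m"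
      using C(2) h[OF x(1)] unfolding cofinal_def by blast
    have "|A x| \<le>o |underS m a|" using h[OF x(1)] under_mono[OF a(2)] ordLeq_transitive by blast
    also have "|underS m a| <o |A (g a)|" using g[OF a(1)] by blast
    also have "|A (g a)| \<le>o |A x|" using card_of_mono1[OF gx[OF a(1)]] .
    finally show False using not_ordLess_ordLeq ordLeq_refl[OF card_of_Card_order] by blast
  qed
  moreover have "g ` C \<subseteq> Field l" using K(1) g by blast
  ultimately have "|K| \<le>o |g ` C|" using K(4) by simp
  then have "|K| \<le>o |C|" by (rule ordLeq_transitive[OF _ card_of_image])
  then have "|C| =o |K|" using CK by (simp add: ordIso_iff_ordLeq)
  then show ?thesis unfolding C(3) by (rule ordIso_transitive[OF _ ordIso_symmetric[OF K(3)]])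
qed

section \<open>Regular cardinals below \<open>l\<close> and change of index set\<close>

text \<open>Omega and successor cardinals need not live on the type \<open>'l\<close>; when they are
  at most \<open>l\<close>, a subset of \<open>Field l\<close> of the same size represents them
  there.\<close>

lemma regularCard_copy:
  fixes l :: "'l rel"
  assumes c: "Cinfinite c" "regularCard c" "c \<le>o l"
  obtains l' :: "'l rel" where "Cinfinite l'" "regularCard l'" "l' \<le>o l" "c =o l'"
proof -
  have "|Field c| \<le>o l" by (rule ordIso_ordLeq_trans[OF Cinfinite_order(7)[OF c(1)] c(3)])
  then obtain S where S: "S \<subseteq> Field l" "|Field c| =o |S|" "|S| \<le>o l"
    using internalize_card_of_ordLeq[of "Field c" l] by blast
  have iso: "c =o |S|"
    by (rule ordIso_transitive[OF ordIso_symmetric[OF Cinfinite_order(7)[OF c(1)]] S(2)])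
  show thesis
    by (rule that[OF Cinfinite_cong[OF iso c(1)] regularCard_ordIso[OF iso c(1,2)] S(3) iso])
qed

lemma regularCard_above:
  fixes l :: "'l rel"
  assumes l: "Cinfinite l" and B: "|B| <o l"
  obtains l' :: "'l rel" where "Cinfinite l'" "regularCard l'" "l' \<le>o l" "|B| <o l'"
proof (cases "finite B")
  case True
  have less: "|B| <o natLeq" using True finite_iff_ordLess_natLeq by blast
  obtain l' :: "'l rel" where l': "Cinfinite l'" "regularCard l'" "l' \<le>o l" "natLeq =o l'"
    by (rule regularCard_copy[OF natLeq_Cinfinite _ natLeq_ordLeq_cinfinite[OF l]])
      (simp add: regularCard_natLeq)
  show thesis by (rule that[OF l'(1-3) ordLess_ordIso_trans[OF less l'(4)]])
next
  case False
  then have B': "Cinfinite |B|" by (simp add: cinfinite_def card_of_card_order_on Field_card_of)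
  have "cardSuc |B| \<le>o l"
    using cardSuc_ordLess_ordLeq[OF card_of_Card_order Cinfinite_order(1)[OF l]] B by blast
  then obtain l' :: "'l rel"
    where l': "Cinfinite l'" "regularCard l'" "l' \<le>o l" "cardSuc |B| =o l'"
    using regularCard_copy[OF Cinfinite_cardSuc[OF B'] regularCard_cardSuc[OF B']] by blast
  show thesis
    by (rule that[OF l'(1-3) ordLess_ordIso_trans[OF cardSuc_greater[OF card_of_Card_order] l'(4)]])
qed

text \<open>\<open>cf\<close> fixes its underlying set by choice, so a family found on another set
  \<open>K\<close> of that size is moved along a bijection, which preserves subsets of full
  cardinality.\<close>

lemma regular_for_reindex:
  fixes k :: "'k rel" and D :: "'i set set"
  assumes eq: "|K| =o k" and k: "Card_order k"
    and X: "\<And>x. x \<in> K \<Longrightarrow> X x \<in> D"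
    and int: "\<And>A. A \<subseteq> K \<Longrightarrow> |A| =o |K| \<Longrightarrow> (\<Inter>x\<in>A. X x) = {}"
  shows "regular_for k k D"
proof -
  have "|Field k| =o |K|"
    by (rule ordIso_transitive[OF card_of_Field_ordIso[OF k] ordIso_symmetric[OF eq]])
  then obtain b where b: "bij_betw b (Field k) K" using card_of_ordIso by blast
  have "(\<Inter>a\<in>A. X (b a)) = {}" if A: "A \<subseteq> Field k" "|A| =o k" for A
  proof -
    have "bij_betw b A (b ` A)"
      by (rule inj_on_imp_bij_betw[OF inj_on_subset[OF bij_betw_imp_inj_on[OF b] A(1)]])
    then have "|b ` A| =o |A|" by (rule ordIso_symmetric[OF card_of_ordIsoI])
    then have "|b ` A| =o |K|"
      by (rule ordIso_transitive[OF _ ordIso_transitive[OF A(2) ordIso_symmetric[OF eq]]])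
    moreover have "b ` A \<subseteq> K" using b A(1) unfolding bij_betw_def by blast
    ultimately have "(\<Inter>x\<in>b ` A. X x) = {}" by (intro int)
    then show ?thesis by simp
  qed
  moreover have "X (b a) \<in> D" if "a \<in> Field k" for a using X bij_betwE[OF b] that by blast
  ultimately show ?thesis unfolding regular_for_def by (intro exI[of _ "\<lambda>a. X (b a)"]) simp
qed

section \<open>Bounding the embeddings on sets in \<open>D\<close>\<close>

theorem theorem2p2:
  fixes l :: "'l rel" and m :: "'m rel" and I :: "'i set" and D :: "'i set set"
  assumes "Cinfinite l" and "Cinfinite m"
    and "cardSuc l \<le>o m"
    and "\<not> cf m =o cf l"
    and "ultrafilter_on I D"
    and "regular_for (cardSuc l) m D"
  shows "regular_for (cf l) (cf l) D \<or>
    (\<exists>l' :: 'l rel. Cinfinite l' \<and> regularCard l' \<and> l' \<le>o l \<and> regular_for l' m D)"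
proof (rule disj_imp[THEN iffD2], rule impI)
  assume nreg: "\<not> regular_for (cf l) (cf l) D"
  note l = assms(1) and m = assms(2)
  have lm: "l <o m"
    using cardSuc_ordLess_ordLeq[OF Cinfinite_order(1)[OF l] Cinfinite_order(1)[OF m]] assms(3)
    by blast
  have D_up: "Y \<in> D" if "X \<in> D" "X \<subseteq> Y" "Y \<subseteq> I" for X Y
    using assms(5) that unfolding ultrafilter_on_def by blast
  have D_int: "X \<inter> Y \<in> D" if "X \<in> D" "Y \<in> D" for X Y
    using assms(5) that unfolding ultrafilter_on_def by blast
  have D_compl: "I - X \<in> D" if "X \<subseteq> I" "X \<notin> D" for X
    using assms(5) that unfolding ultrafilter_on_def by blast
  obtain f where f: "\<And>i. i \<in> I \<Longrightarrow> f i \<subseteq> Field m \<and> |f i| <o cardSuc l"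
    and fD: "\<And>a. a \<in> Field m \<Longrightarrow> {i \<in> I. a \<in> f i} \<in> D"
    using assms(6) unfolding regular_for_iff[OF Cinfinite_cardSuc[OF l] assms(5)] by auto
  have "\<exists>j. inj_on j (f i) \<and> j ` f i \<subseteq> Field l" if "i \<in> I" for i
  proof -
    have "|f i| \<le>o l"
      using f[OF that] cardSuc_ordLeq_ordLess[OF Cinfinite_order(1)[OF l] card_of_Card_order]
      by blast
    then have "|f i| \<le>o |Field l|"
      by (rule ordLeq_ordIso_trans[OF _ ordIso_symmetric[OF Cinfinite_order(7)[OF l]]])
    then show ?thesis using card_of_ordLeq by blast
  qed
  then obtain j where j: "\<And>i. i \<in> I \<Longrightarrow> inj_on (j i) (f i) \<and> j i ` f i \<subseteq> Field l" by metis
  obtain K where K: "K \<subseteq> Field l" "cofinal K l" "cf l =o |K|"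
    "\<And>K'. K' \<subseteq> Field l \<Longrightarrow> cofinal K' l \<Longrightarrow> |K| \<le>o |K'|"
    "\<And>A. A \<subseteq> K \<Longrightarrow> |A| =o |K| \<Longrightarrow> cofinal A l"
    using cf_thin_witness[OF l] by blast
  define F where "F x i = {a \<in> f i. j i a \<in> underS l x}" for x i
  define A where "A x = {a \<in> Field m. {i \<in> I. a \<in> F x i} \<in> D}" for x
  have mono: "A x \<subseteq> A y" if "(x, y) \<in> l" for x y
  proof
    fix a assume "a \<in> A x"
    moreover have "F x i \<subseteq> F y i" for i
      using that Cinfinite_order(3,4)[OF l]
      unfolding F_def underS_def trans_def antisym_def by blast
    ultimately show "a \<in> A y"
      unfolding A_def using D_up[of "{i \<in> I. a \<in> F x i}" "{i \<in> I. a \<in> F y i}"] by blast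
  qed
  have cover: "Field m \<subseteq> (\<Union>x\<in>K. A x)"
  proof (rule ccontr)
    assume "\<not> ?thesis"
    then obtain a where a: "a \<in> Field m" "\<And>x. x \<in> K \<Longrightarrow> {i \<in> I. a \<in> F x i} \<notin> D"
      unfolding A_def by blast
    \<comment> \<open>Here \<open>a\<close> is in \<open>f i\<close> but \<open>j i a\<close> is not
      below \<open>x\<close>. No \<open>i\<close> does this for cofinally many \<open>x\<close>,
      since \<open>j i a\<close> is strictly below one of them.\<close>
    define X where "X x = {i \<in> I. a \<in> f i} \<inter> (I - {i \<in> I. a \<in> F x i})" for x
    have "regular_for (cf l) (cf l) D"
    proof (rule regular_for_reindex[where X = X])
      show "|K| =o cf l" using K(3) by (rule ordIso_symmetric)
      show "Card_order (cf l)" unfolding cf_def by (rule card_of_Card_order)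
      show "X x \<in> D" if "x \<in> K" for x
        unfolding X_def using a that by (intro D_int D_compl fD) auto
      fix B assume B: "B \<subseteq> K" "|B| =o |K|"
      have cofB: "cofinal B l" using K(5)[OF B] .
      show "(\<Inter>x\<in>B. X x) = {}"
      proof (rule ccontr)
        assume "(\<Inter>x\<in>B. X x) \<noteq> {}"
        then obtain i where i: "\<And>x. x \<in> B \<Longrightarrow> i \<in> X x" by blast
        \<comment> \<open>The intersection over an empty \<open>B\<close> would be everything; a
          member of \<open>B\<close> is what puts \<open>i\<close> in \<open>I\<close> and
          \<open>a\<close> in \<open>f i\<close>.\<close>
        have "B \<noteq> {}" using cofB Cinfinite_order(6)[OF l] unfolding cofinal_def by fastforce
        then have ia: "i \<in> I" "a \<in> f i" using i unfolding X_def by blast+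
        then have "j i a \<in> Field l" using j by blast
        then obtain x where "x \<in> B" "j i a \<in> underS l x"
          using cofB unfolding cofinal_def underS_def by blast
        then show False using i[of x] ia unfolding X_def F_def by blast
      qed
    qed
    then show False using nreg by blast
  qed
  have "\<exists>x\<in>K. \<not> |A x| <o m"
    using cf_eq_of_small_chain[OF l m lm K(1-4) mono cover] assms(4) by auto
  then obtain x where x: "x \<in> K" "m \<le>o |A x|"
    using not_ordLess_iff_ordLeq card_of_Well_order Cinfinite_order(2)[OF m] by blast
  then have "|Field m| \<le>o |A x|"
    using Cinfinite_order(7)[OF m] ordIso_ordLeq_trans by blast
  \<comment> \<open>\<open>A x\<close> has full size but may omit elements of
    \<open>Field m\<close>; \<open>b\<close> renames \<open>Field m\<close> inside it so that every
    index is served.\<close>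
  then obtain b where b: "inj_on b (Field m)" "b ` Field m \<subseteq> A x"
    using card_of_ordLeq[of "Field m" "A x"] by blast
  have "|underS l x| <o l" using card_of_underS[OF Cinfinite_order(1)[OF l]] x(1) K(1) by blast
  then obtain l' :: "'l rel" where l': "Cinfinite l'" "regularCard l'" "l' \<le>o l"
    and ul: "|underS l x| <o l'"
    by (rule regularCard_above[OF l])
  \<comment> \<open>Pulling back along \<open>b\<close> keeps the size bound: \<open>j i\<close>
    after \<open>b\<close> embeds \<open>g i\<close> into \<open>underS l x\<close>, the same set
    for all \<open>i\<close>.\<close>
  define g where "g i = {a \<in> Field m. b a \<in> F x i}" for i
  have "|g i| <o l'" if i: "i \<in> I" for i
  proof -
    have "inj_on b (g i)" using b(1) unfolding g_def by (rule inj_on_subset) blast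
    moreover have "inj_on (j i) (b ` g i)"
      using j[OF i] by (auto simp: g_def F_def intro: inj_on_subset)
    ultimately have "inj_on (j i \<circ> b) (g i)" by (rule comp_inj_on)
    moreover have "(j i \<circ> b) ` g i \<subseteq> underS l x" unfolding g_def F_def by auto
    ultimately have "|g i| \<le>o |underS l x|" using card_of_ordLeq by blast
    then show ?thesis using ul ordLeq_ordLess_trans by blast
  qed
  moreover have "{i \<in> I. a \<in> g i} \<in> D" if "a \<in> Field m" for a
  proof -
    have "{i \<in> I. a \<in> g i} = {i \<in> I. b a \<in> F x i}" using that unfolding g_def by blast
    then show ?thesis using b(2) that unfolding A_def by auto
  qed
  moreover have "g i \<subseteq> Field m" for i unfolding g_def by blast
  ultimately have "regular_for l' m D"
    unfolding regular_for_iff[OF l'(1) assms(5)] by (intro exI[of _ g]) blast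
  then show "\<exists>l' :: 'l rel. Cinfinite l' \<and> regularCard l' \<and> l' \<le>o l \<and> regular_for l' m D"
    using l' by blast
qed

end
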